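(* Let $R$ be a commutative ring with unity and let $f:M\to M'$ be a homomorphism of unitary $R$-modules. If $B=(\mu_B,\nu_B)$ is an intuitionistic fuzzy primary submodule of $M'$, then $f^{-1}(B)$ is an intuitionistic fuzzy primary submodule of $M$.
   Context: Rings are commutative with unity $1\neq 0$, modules are unitary, $\theta$ is the zero element of a module, $\mathbb{N}=\{1,2,\dots\}$, and $\bigvee,\bigwedge$ (or $\vee,\wedge$) denote supremum and infimum in $[0,1]$. An intuitionistic fuzzy subset of a non-empty set $X$ is a pair $A=(\mu_A,\nu_A)$ of functions $X\to[0,1]$ with $\mu_A(x)+\nu_A(x)\le 1$ for all $x\in X$. Intuitionistic fuzzy submodule of an $R$-module $M$: an intuitionistic fuzzy subset $A$ of $M$ with (1) $\mu_A(\theta)=1$, $\nu_A(\theta)=0$; (2) $\mu_A(x+y)\ge\mu_A(x)\wedge\mu_A(y)$ and $\nu_A(x+y)\le\nu_A(x)\vee\nu_A(y)$ for all $x,y\in M$; (3) $\mu_A(rx)\ge\mu_A(x)$ and $\nu_A(rx)\le\nu_A(x)$ for all $x\in M$, $r\in R$. Radical: for an intuitionistic fuzzy subset $A$ of $M$, $\sqrt{A}=(\sqrt{\mu_A},\sqrt{\nu_A})$ is the intuitionistic fuzzy subset of $R$ given by $\sqrt{\mu_A}(r)=\bigvee_{n\in\mathbb{N}}\bigwedge_{m\in M}\mu_A(r^n m)$ and $\sqrt{\nu_A}(r)=\bigwedge_{n\in\mathbb{N}}\bigvee_{m\in M}\nu_A(r^n m)$. Intuitionistic fuzzy primary submodule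 of $M$: an intuitionistic fuzzy submodule $A$ of $M$ such that for all $r\in R$, $m\in M$, either [$\mu_A(rm)=\mu_A(m)$ and $\nu_A(rm)=\nu_A(m)$] or [$\mu_A(rm)\le\sqrt{\mu_A}(r)$ and $\nu_A(rm)\ge\sqrt{\nu_A}(r)$]. Inverse image: for $f:M\to M'$ and an intuitionistic fuzzy submodule $B$ of $M'$, $f^{-1}(B)=(\mu_B\circ f,\nu_B\circ f)$, i.e. $f^{-1}(B)(x)=B(f(x))$ for $x\in M$. *)

theory Defs imports Complex_Main begin

text \<open>
  Modules are those of \<^locale>\<open>module\<close>: the ring and the module are types, and the action
  is a function \<open>scale\<close>. All fuzzy subsets below are subsets of a whole type.
\<close>

type_synonym 'a ifuzzy = "('a \<Rightarrow> real) \<times> ('a \<Rightarrow> real)"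

definition mem :: "'a ifuzzy \<Rightarrow> 'a \<Rightarrow> real" where
  "mem A = fst A"

definition nonmem :: "'a ifuzzy \<Rightarrow> 'a \<Rightarrow> real" where
  "nonmem A = snd A"

definition if_subset :: "'a ifuzzy \<Rightarrow> bool" where
  "if_subset A \<longleftrightarrow>
     (\<forall>x. mem A x \<in> {0..1} \<and> nonmem A x \<in> {0..1} \<and> mem A x + nonmem A x \<le> 1)"

definition if_submodule ::
    "('r::comm_ring_1 \<Rightarrow> 'm::ab_group_add \<Rightarrow> 'm) \<Rightarrow> 'm ifuzzy \<Rightarrow> bool" where
  "if_submodule scale A \<longleftrightarrow>
     if_subset A \<and>
     mem A 0 = 1 \<and> nonmem A 0 = 0 \<and>
     (\<forall>x y. mem A (x + y) \<ge> min (mem A x) (mem A y) \<and>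
            nonmem A (x + y) \<le> max (nonmem A x) (nonmem A y)) \<and>
     (\<forall>r x. mem A (scale r x) \<ge> mem A x \<and> nonmem A (scale r x) \<le> nonmem A x)"

text \<open>
  Exponents start at 1. Under \<^term>\<open>if_subset A\<close> the families below are nonempty and take values
  in \<open>[0,1]\<close>, so their suprema and infima in the reals are those in \<open>[0,1]\<close>.
\<close>

definition if_radical ::
    "('r::comm_ring_1 \<Rightarrow> 'm::ab_group_add \<Rightarrow> 'm) \<Rightarrow> 'm ifuzzy \<Rightarrow> 'r ifuzzy" where
  "if_radical scale A =
     (\<lambda>r. SUP n\<in>{1::nat..}. INF m. mem A (scale (r ^ n) m),
      \<lambda>r. INF n\<in>{1::nat..}. SUP m. nonmem A (scale (r ^ n) m))"

definition if_primary_submodule ::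
    "('r::comm_ring_1 \<Rightarrow> 'm::ab_group_add \<Rightarrow> 'm) \<Rightarrow> 'm ifuzzy \<Rightarrow> bool" where
  "if_primary_submodule scale A \<longleftrightarrow>
     if_submodule scale A \<and>
     (\<forall>r m. (mem A (scale r m) = mem A m \<and> nonmem A (scale r m) = nonmem A m) \<or>
            (mem A (scale r m) \<le> mem (if_radical scale A) r \<and>
             nonmem A (scale r m) \<ge> nonmem (if_radical scale A) r))"

definition if_vimage :: "('m \<Rightarrow> 'n) \<Rightarrow> 'n ifuzzy \<Rightarrow> 'm ifuzzy" where
  "if_vimage f B = (mem B \<circ> f, nonmem B \<circ> f)"

end

theory Submission imports Defs begin

text \<open>
  Since \<open>f\<close> is linear, the degrees of \<open>x + y\<close> in the inverse image are those of
  \<open>f(x) + f(y)\<close> in \<open>B\<close>, and the degrees of \<open>r m\<close> in the inverse image are those of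
  \<open>r f(m)\<close> in \<open>B\<close>. The submodule axioms, and the first alternative in the definition of a primary
  submodule, are therefore instances of the same conditions on \<open>B\<close>.

  Only the second alternative needs an argument, because the radical of the inverse image is
  computed over the range of \<open>f\<close>, not over all of the target module. Shrinking the range of the
  inner infimum can only increase it, and shrinking that of the inner supremum can only decrease
  it. So the radical of the inverse image contains the radical of \<open>B\<close> (lemmas
  \<open>mem_radical_le_vimage\<close> and \<open>nonmem_radical_vimage_le\<close>), which is the direction in which the
  bounds on \<open>B\<close> have to be relaxed. The inclusion can be strict when \<open>f\<close> is not surjective.
\<close>

lemma mem_vimage [simp]: "mem (if_vimage f B) x = mem B (f x)"
  and nonmem_vimage [simp]: "nonmem (if_vimage f B) x = nonmem B (f x)"
  by (simp_all add: if_vimage_def mem_def nonmem_def)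

lemma mem_radical: "mem (if_radical scale A) r = (SUP n\<in>{1::nat..}. INF m. mem A (scale (r ^ n) m))"
  and nonmem_radical:
    "nonmem (if_radical scale A) r = (INF n\<in>{1::nat..}. SUP m. nonmem A (scale (r ^ n) m))"
  by (simp_all add: if_radical_def mem_def nonmem_def)

lemma if_subsetD:
  assumes "if_subset A"
  shows "0 \<le> mem A x" "mem A x \<le> 1" "0 \<le> nonmem A x" "nonmem A x \<le> 1"
  using assms by (auto simp: if_subset_def)

lemma if_submodule_vimage:
  assumes "module_hom scale scale' f" and "if_submodule scale' B"
  shows "if_submodule scale (if_vimage f B)"
proof -
  interpret module_hom scale scale' f by fact
  show ?thesis
    using assms(2) by (simp add: if_submodule_def if_subset_def add scale zero)
qed

text \<open>
  Real suprema and infima are monotone only for bounded families. The values of \<open>B\<close> lie in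
  \<open>[0,1]\<close>, which bounds both the inner families and the outer families of their extrema.
\<close>

lemma mem_radical_le_vimage:
  assumes "module_hom scale scale' f" and B: "if_subset B"
  shows "mem (if_radical scale' B) r \<le> mem (if_radical scale (if_vimage f B)) r"
proof -
  interpret module_hom scale scale' f by fact
  note bounds = if_subsetD[OF B]
  have bdd: "bdd_below (range (\<lambda>x. mem B (g x)))" for g :: "'x \<Rightarrow> _"
    using bounds by (intro bdd_belowI[of _ 0]) auto
  have inner: "(INF y. mem B (scale' (r ^ n) y)) \<le> (INF x. mem B (scale' (r ^ n) (f x)))" for n
    by (intro cINF_greatest cINF_lower bdd) auto
  have "(INF x. mem B (scale' (r ^ n) (f x))) \<le> 1" for n
    by (rule cINF_lower2[OF bdd, of 0]) (use bounds in auto)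
  then have "bdd_above ((\<lambda>n. INF x. mem B (scale' (r ^ n) (f x))) ` {1..})"
    by (intro bdd_aboveI[of _ 1]) auto
  then show ?thesis
    unfolding mem_radical mem_vimage scale using inner by (intro cSUP_mono) auto
qed

lemma nonmem_radical_vimage_le:
  assumes "module_hom scale scale' f" and B: "if_subset B"
  shows "nonmem (if_radical scale (if_vimage f B)) r \<le> nonmem (if_radical scale' B) r"
proof -
  interpret module_hom scale scale' f by fact
  note bounds = if_subsetD[OF B]
  have bdd: "bdd_above (range (\<lambda>x. nonmem B (g x)))" for g :: "'x \<Rightarrow> _"
    using bounds by (intro bdd_aboveI[of _ 1]) auto
  have inner: "(SUP x. nonmem B (scale' (r ^ n) (f x))) \<le> (SUP y. nonmem B (scale' (r ^ n) y))" for n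
    by (intro cSUP_least cSUP_upper bdd) auto
  have "0 \<le> (SUP x. nonmem B (scale' (r ^ n) (f x)))" for n
    by (rule cSUP_upper2[OF bdd, of 0]) (use bounds in auto)
  then have "bdd_below ((\<lambda>n. SUP x. nonmem B (scale' (r ^ n) (f x))) ` {1..})"
    by (intro bdd_belowI[of _ 0]) auto
  then show ?thesis
    unfolding nonmem_radical nonmem_vimage scale using inner by (intro cINF_mono) auto
qed

theorem theorem3p23:
  fixes scale :: "'r::comm_ring_1 \<Rightarrow> 'm::ab_group_add \<Rightarrow> 'm"
    and scale' :: "'r \<Rightarrow> 'n::ab_group_add \<Rightarrow> 'n"
    and f :: "'m \<Rightarrow> 'n"
    and B :: "'n ifuzzy"
  assumes "module_hom scale scale' f"
    and "if_primary_submodule scale' B"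
  shows "if_primary_submodule scale (if_vimage f B)"
proof -
  interpret module_hom scale scale' f by fact
  have sub: "if_submodule scale' B"
    and primary: "\<And>r y. (mem B (scale' r y) = mem B y \<and> nonmem B (scale' r y) = nonmem B y) \<or>
        (mem B (scale' r y) \<le> mem (if_radical scale' B) r \<and>
         nonmem B (scale' r y) \<ge> nonmem (if_radical scale' B) r)"
    using assms(2) by (auto simp: if_primary_submodule_def)
  from sub have "if_subset B" by (simp add: if_submodule_def)
  note radical = mem_radical_le_vimage[OF assms(1) this] nonmem_radical_vimage_le[OF assms(1) this]
  show ?thesis
    unfolding if_primary_submodule_def mem_vimage nonmem_vimage scale
    using if_submodule_vimage[OF assms(1) sub] primary radical by (meson order_trans)
qed

end
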